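(* For every positive integer $n$, the edge-chromatic sum of the complete graph $K_n$ on $n$ vertices is $$\Sigma'(K_n)=\begin{cases}\frac{n(n^2-1)}{4}, & \text{if } n \text{ is odd},\\[2pt] \frac{(n-1)n^2}{4}, & \text{if } n \text{ is even}.\end{cases}$$
   Context: A proper edge-coloring of a graph $G$ is a map $\alpha:E(G)\to\mathbb{N}=\{1,2,\dots\}$ such that adjacent edges receive distinct colors. For such $\alpha$, $\Sigma'(G,\alpha)=\sum_{e\in E(G)}\alpha(e)$. The edge-chromatic sum of $G$ is $\Sigma'(G)=\min_\alpha \Sigma'(G,\alpha)$, the minimum over all proper edge-colorings $\alpha$ of $G$. *)

theory Defs
  imports Complex_Main
begin

text \<open>
  A simple graph is a pair of a vertex set and a set of edges, the edges being two-element
  sets of vertices. Only finite graphs are meant: on an infinite edge set \<^const>\<open>sum\<close> is 0.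
\<close>

type_synonym 'a sgraph = "'a set \<times> 'a set set"

abbreviation vertices :: "'a sgraph \<Rightarrow> 'a set" where
  "vertices G \<equiv> fst G"

abbreviation edges :: "'a sgraph \<Rightarrow> 'a set set" where
  "edges G \<equiv> snd G"

definition finite_simple_graph :: "'a sgraph \<Rightarrow> bool" where
  "finite_simple_graph G \<longleftrightarrow>
     finite (vertices G) \<and> (\<forall>e \<in> edges G. e \<subseteq> vertices G \<and> card e = 2)"

definition complete_graph :: "'a set \<Rightarrow> 'a sgraph" where
  "complete_graph V = (V, {e. e \<subseteq> V \<and> card e = 2})"

text \<open>
  Colors are positive. A coloring is a total function on sets, but its values outside
  the edge set are irrelevant.
\<close>

definition proper_edge_coloring :: "'a sgraph \<Rightarrow> ('a set \<Rightarrow> nat) \<Rightarrow> bool" where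
  "proper_edge_coloring G \<alpha> \<longleftrightarrow>
     (\<forall>e \<in> edges G. \<alpha> e \<ge> 1) \<and>
     (\<forall>e \<in> edges G. \<forall>f \<in> edges G. e \<noteq> f \<and> e \<inter> f \<noteq> {} \<longrightarrow> \<alpha> e \<noteq> \<alpha> f)"

definition coloring_sum :: "'a sgraph \<Rightarrow> ('a set \<Rightarrow> nat) \<Rightarrow> nat" where
  "coloring_sum G \<alpha> = (\<Sum>e \<in> edges G. \<alpha> e)"

definition edge_chromatic_sum :: "'a sgraph \<Rightarrow> nat" where
  "edge_chromatic_sum G = (LEAST s. \<exists>\<alpha>. proper_edge_coloring G \<alpha> \<and> coloring_sum G \<alpha> = s)"

lemma finite_simple_graph_complete_graph:
  "finite V \<Longrightarrow> finite_simple_graph (complete_graph V)"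
  by (simp add: finite_simple_graph_def complete_graph_def)

text \<open>The minimum ranges over a nonempty set of values, so it is attained.\<close>

lemma finite_edges:
  assumes "finite_simple_graph G"
  shows "finite (edges G)"
proof (rule finite_subset)
  show "edges G \<subseteq> Pow (vertices G)" "finite (Pow (vertices G))"
    using assms by (auto simp: finite_simple_graph_def)
qed

lemma proper_edge_coloring_exists:
  assumes "finite_simple_graph G"
  shows "\<exists>\<alpha>. proper_edge_coloring G \<alpha>"
proof -
  obtain f :: "'a set \<Rightarrow> nat" where "inj_on f (edges G)"
    using finite_imp_inj_to_nat_seg[OF finite_edges[OF assms]] by blast
  then have "proper_edge_coloring G (\<lambda>e. Suc (f e))"
    by (auto simp: proper_edge_coloring_def inj_on_def)
  then show ?thesis by blast
qed

lemma edge_chromatic_sum_attained: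
  assumes "finite_simple_graph G"
  shows "\<exists>\<alpha>. proper_edge_coloring G \<alpha> \<and> coloring_sum G \<alpha> = edge_chromatic_sum G"
  unfolding edge_chromatic_sum_def
  by (rule LeastI_ex) (use proper_edge_coloring_exists[OF assms] in blast)

lemma edge_chromatic_sum_le:
  "proper_edge_coloring G \<alpha> \<Longrightarrow> edge_chromatic_sum G \<le> coloring_sum G \<alpha>"
  unfolding edge_chromatic_sum_def by (rule Least_le) blast

end

theory Submission
  imports Defs "HOL-Number_Theory.Cong"
begin

text \<open>
  A color class of a complete graph on \<open>n\<close> vertices is a matching, so it has at most
  \<open>m = n div 2\<close> edges, and the number of edges is \<open>m * p\<close> where \<open>p\<close> is the odd one of \<open>n\<close> and
  \<open>n - 1\<close>. Hence the color sum is smallest when each of the colors \<open>1, \<dots>, p\<close> is used \<open>m\<close> times,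
  which happens for every proper coloring with \<open>p\<close> colors. Such a coloring is the round-robin
  schedule: on the vertices \<open>0, \<dots>, p - 1\<close> color \<open>{i, j}\<close> by \<open>i + j\<close> modulo \<open>p\<close>; an additional
  vertex is joined to \<open>i\<close> by the color \<open>2 * i\<close>, the one missing at \<open>i\<close>.
\<close>

text \<open>Disjoint pairs: their union has \<open>2 * card M\<close> elements and lies in
  \<open>V\<close>.\<close>

lemma card_matching_le:
  assumes "finite V" and "\<And>e. e \<in> M \<Longrightarrow> e \<subseteq> V \<and> card e = 2" and "pairwise disjnt M"
  shows "card M \<le> card V div 2"
proof -
  have "finite e" if "e \<in> M" for e
    using assms(1,2) that by (blast intro: finite_subset)
  then have "card (\<Union>M) = sum card M"
    using assms(3) by (intro card_Union_disjoint)
  also have "\<dots> = 2 * card M"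
    using assms(2) by simp
  finally have "2 * card M = card (\<Union>M)" ..
  also have "\<dots> \<le> card V"
    using assms(1,2) by (intro card_mono) auto
  finally show ?thesis by simp
qed

text \<open>Group the edges by color. The weight \<open>w\<close> is left free because the lower
  bound takes the slack \<open>Suc p - c\<close>, the upper bound the color itself.\<close>

lemma sum_comp_le:
  fixes w :: "'b \<Rightarrow> nat"
  assumes "finite E" and "finite C" and "\<And>c. c \<in> C \<Longrightarrow> card {e \<in> E. \<alpha> e = c} \<le> m"
  shows "(\<Sum>e | e \<in> E \<and> \<alpha> e \<in> C. w (\<alpha> e)) \<le> m * sum w C"
proof -
  have "(\<Sum>e | e \<in> E \<and> \<alpha> e \<in> C. w (\<alpha> e)) =
      (\<Sum>c\<in>C. \<Sum>e | e \<in> {e \<in> E. \<alpha> e \<in> C} \<and> \<alpha> e = c. w (\<alpha> e))"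
    using assms(1,2) by (intro sum.group[symmetric]) auto
  also have "\<dots> = (\<Sum>c\<in>C. card {e \<in> E. \<alpha> e = c} * w c)"
  proof (rule sum.cong[OF refl])
    fix c assume "c \<in> C"
    then have "{e. e \<in> {e \<in> E. \<alpha> e \<in> C} \<and> \<alpha> e = c} = {e \<in> E. \<alpha> e = c}" by auto
    then show "(\<Sum>e | e \<in> {e \<in> E. \<alpha> e \<in> C} \<and> \<alpha> e = c. w (\<alpha> e)) = card {e \<in> E. \<alpha> e = c} * w c"
      by simp
  qed
  also have "\<dots> \<le> (\<Sum>c\<in>C. m * w c)"
    using assms(3) by (intro sum_mono mult_right_mono) auto
  finally show ?thesis by (simp add: sum_distrib_left)
qed

lemma double_sum_Icc: "2 * \<Sum>{1..p} = p * (p + 1)" for p :: nat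
  by (induction p) auto

lemma double_sum_Icc_rev: "2 * (\<Sum>c = 1..p. Suc p - c) = p * (p + 1)" for p :: nat
  by (subst sum.atLeastAtMost_rev) (simp add: double_sum_Icc[simplified])

lemma card_color_class_le:
  assumes "finite V" and "proper_edge_coloring (complete_graph V) \<alpha>"
  shows "card {e \<in> edges (complete_graph V). \<alpha> e = c} \<le> card V div 2"
proof (rule card_matching_le[OF assms(1)])
  show "e \<subseteq> V \<and> card e = 2" if "e \<in> {e \<in> edges (complete_graph V). \<alpha> e = c}" for e
    using that by (simp add: complete_graph_def)
  show "pairwise disjnt {e \<in> edges (complete_graph V). \<alpha> e = c}"
    using assms(2) unfolding proper_edge_coloring_def pairwise_def disjnt_def by blast
qed

text \<open>Give each edge the slack \<open>Suc p - \<alpha> e\<close>. Color plus slack is at least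
  \<open>p + 1\<close>, so by the edge count all colors and slacks add up to at least
  \<open>m * p * (p + 1)\<close> with \<open>m = card V div 2\<close>. The slacks contribute at most
  half of that, and the colors must supply the rest.\<close>

lemma coloring_sum_ge:
  assumes "finite V" and "proper_edge_coloring (complete_graph V) \<alpha>"
    and "card (edges (complete_graph V)) = card V div 2 * p"
  shows "card V div 2 * p * (p + 1) \<le> 2 * coloring_sum (complete_graph V) \<alpha>"
proof -
  let ?E = "edges (complete_graph V)" and ?m = "card V div 2"
  have fin: "finite ?E"
    using assms(1) by (intro finite_edges finite_simple_graph_complete_graph)
  have "\<alpha> e \<ge> 1" if "e \<in> ?E" for e
    using assms(2) that by (simp add: proper_edge_coloring_def)
  \<comment> \<open>Truncated subtraction gives slack 0 to all colors above \<open>p\<close>, so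
    only \<open>p\<close> color classes count.\<close>
  then have "(\<Sum>e\<in>?E. Suc p - \<alpha> e) = (\<Sum>e | e \<in> ?E \<and> \<alpha> e \<in> {1..p}. Suc p - \<alpha> e)"
    by (intro sum.mono_neutral_right) (auto simp: fin)
  also have "\<dots> \<le> ?m * (\<Sum>c = 1..p. Suc p - c)"
    using card_color_class_le[OF assms(1,2)] by (intro sum_comp_le) (auto simp: fin)
  finally have slack: "2 * (\<Sum>e\<in>?E. Suc p - \<alpha> e) \<le> ?m * (p * (p + 1))"
    using double_sum_Icc_rev[of p] by (metis mult.left_commute mult_le_mono2)
  have "?m * p * (p + 1) = (\<Sum>e\<in>?E. Suc p)"
    using assms(3) by simp
  also have "\<dots> \<le> (\<Sum>e\<in>?E. \<alpha> e + (Suc p - \<alpha> e))"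
    by (intro sum_mono) simp
  finally have "?m * p * (p + 1) \<le> coloring_sum (complete_graph V) \<alpha> + (\<Sum>e\<in>?E. Suc p - \<alpha> e)"
    by (simp add: sum.distrib coloring_sum_def)
  with slack show ?thesis by (simp add: algebra_simps)
qed

lemma coloring_sum_le:
  assumes "finite V" and "proper_edge_coloring (complete_graph V) \<alpha>"
    and "\<And>e. e \<in> edges (complete_graph V) \<Longrightarrow> \<alpha> e \<le> p"
  shows "2 * coloring_sum (complete_graph V) \<alpha> \<le> card V div 2 * p * (p + 1)"
proof -
  let ?E = "edges (complete_graph V)"
  have fin: "finite ?E"
    using assms(1) by (intro finite_edges finite_simple_graph_complete_graph)
  have "\<alpha> e \<in> {1..p}" if "e \<in> ?E" for e
    using assms(2,3) that by (simp add: proper_edge_coloring_def)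
  then have "{e. e \<in> ?E \<and> \<alpha> e \<in> {1..p}} = ?E" by blast
  moreover have "(\<Sum>e | e \<in> ?E \<and> \<alpha> e \<in> {1..p}. \<alpha> e) \<le> card V div 2 * \<Sum>{1..p}"
    using card_color_class_le[OF assms(1,2)] by (intro sum_comp_le) (auto simp: fin)
  ultimately have "coloring_sum (complete_graph V) \<alpha> \<le> card V div 2 * \<Sum>{1..p}"
    by (simp add: coloring_sum_def)
  then have "2 * coloring_sum (complete_graph V) \<alpha> \<le> card V div 2 * (2 * \<Sum>{1..p})"
    by linarith
  then show ?thesis
    by (simp only: double_sum_Icc mult.assoc)
qed

text \<open>Here \<open>p\<close> is the additional vertex. Sums over the set \<open>e\<close> make
  the formula independent of the order of the endpoints.\<close>

definition round_robin :: "nat \<Rightarrow> nat set \<Rightarrow> nat" where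
  "round_robin p e = (if p \<in> e then 2 * \<Sum>(e - {p}) else \<Sum>e) mod p"

lemma add_mod_left_cancel:
  fixes v a b p :: nat
  assumes "(v + a) mod p = (v + b) mod p" and "a < p" and "b < p"
  shows "a = b"
  using assms by (metis cong_def cong_add_lcancel_nat mod_less)

lemma double_mod_cancel:
  fixes a b p :: nat
  assumes "odd p" and "(2 * a) mod p = (2 * b) mod p" and "a < p" and "b < p"
  shows "a = b"
  using assms by (metis cong_def cong_mult_lcancel_nat coprime_left_2_iff_odd mod_less)

lemma round_robin_insert_p: "i \<noteq> p \<Longrightarrow> round_robin p {i, p} = (2 * i) mod p"
  by (simp add: round_robin_def insert_Diff_if)

lemma round_robin_pair:
  "i \<noteq> j \<Longrightarrow> i \<noteq> p \<Longrightarrow> j \<noteq> p \<Longrightarrow> round_robin p {i, j} = (i + j) mod p"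
  by (simp add: round_robin_def)

text \<open>At a vertex \<open>v < p\<close>, the edge to \<open>p\<close> has color
  \<open>v + v\<close>, as if \<open>v\<close> were its own partner, so translation by
  \<open>v\<close> modulo \<open>p\<close> separates all edges. At \<open>v = p\<close> the colors
  are doubles, and 2 is invertible modulo the odd \<open>p\<close>.\<close>

lemma round_robin_inj:
  assumes "odd p" and "v \<le> p" "a \<le> p" "b \<le> p" and "v \<noteq> a" "v \<noteq> b"
    and "round_robin p {v, a} = round_robin p {v, b}"
  shows "a = b"
proof -
  consider "v = p" "a < p" "b < p" | "v < p" "a < p" "b < p" | "v < p" "a = p" "b < p"
    | "v < p" "a < p" "b = p" | "a = p" "b = p"
    using assms(2-6) by linarith
  then show ?thesis
  proof cases
    case 1
    then have "(2 * a) mod p = (2 * b) mod p"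
      using assms(7) by (metis insert_commute less_irrefl round_robin_insert_p)
    then show ?thesis using double_mod_cancel[OF assms(1)] 1 by blast
  next
    case 2
    then have "(v + a) mod p = (v + b) mod p"
      using assms(5-7) by (metis less_irrefl round_robin_pair)
    then show ?thesis using add_mod_left_cancel 2 by blast
  next
    \<comment> \<open>Cancelling \<open>v\<close> would give \<open>v = b\<close>, against the
      assumption that \<open>v\<close> and \<open>b\<close> differ.\<close>
    case 3
    then have "(v + v) mod p = (v + b) mod p"
      using assms(5-7) by (metis less_irrefl mult_2 round_robin_insert_p round_robin_pair)
    then show ?thesis using add_mod_left_cancel 3 assms(6) by blast
  next
    case 4
    then have "(v + v) mod p = (v + a) mod p"
      using assms(5-7) by (metis less_irrefl mult_2 round_robin_insert_p round_robin_pair)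
    then show ?thesis using add_mod_left_cancel 4 assms(5) by blast
  qed simp
qed

text \<open>Both parities at once: any injection of \<open>V\<close> into \<open>{..p}\<close> pulls
  the schedule back, whether or not it is onto. \<open>Suc\<close> turns the residues
  \<open>0, \<dots>, p - 1\<close> into positive colors.\<close>

lemma exists_coloring_complete_graph:
  assumes "finite V" and "odd p" and "card V \<le> p + 1"
  obtains \<alpha> where "proper_edge_coloring (complete_graph V) \<alpha>" and "\<And>e. \<alpha> e \<le> p"
proof -
  obtain f where f: "f ` V \<subseteq> {..p}" "inj_on f V"
    using card_le_inj[of V "{..p}"] assms by auto
  define \<alpha> where "\<alpha> e = Suc (round_robin p (f ` e))" for e
  have "proper_edge_coloring (complete_graph V) \<alpha>"
    unfolding proper_edge_coloring_def
  proof (intro conjI ballI impI notI)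
    fix e e'
    assume e: "e \<in> edges (complete_graph V)" and e': "e' \<in> edges (complete_graph V)"
      and adj: "e \<noteq> e' \<and> e \<inter> e' \<noteq> {}" and eq: "\<alpha> e = \<alpha> e'"
    \<comment> \<open>Writing both edges with their common endpoint first reduces properness to
      \<open>round_robin_inj\<close>.\<close>
    obtain v where v: "v \<in> e" "v \<in> e'" using adj by blast
    have pair: "\<exists>a. d = {v, a} \<and> v \<noteq> a"
      if "d \<in> edges (complete_graph V)" "v \<in> d" for d
      using that by (auto simp: complete_graph_def card_2_iff)
    obtain a where a: "e = {v, a}" "v \<noteq> a" using pair e v by blast
    obtain b where b: "e' = {v, b}" "v \<noteq> b" using pair e' v by blast
    have V: "v \<in> V" "a \<in> V" "b \<in> V"
      using e e' a b by (auto simp: complete_graph_def)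
    have "f a = f b"
    proof (rule round_robin_inj[OF assms(2)])
      show "f v \<le> p" "f a \<le> p" "f b \<le> p" using f V by auto
      show "f v \<noteq> f a" "f v \<noteq> f b" using f V a b by (auto dest: inj_onD)
      show "round_robin p {f v, f a} = round_robin p {f v, f b}"
        using eq a b by (simp add: \<alpha>_def)
    qed
    then have "a = b" using f V by (auto dest: inj_onD)
    then show False using adj a b by simp
  qed (simp add: \<alpha>_def)
  moreover have "\<alpha> e \<le> p" for e
    using odd_pos[OF assms(2)] by (simp add: \<alpha>_def round_robin_def Suc_le_eq)
  ultimately show ?thesis using that by blast
qed

lemma edge_chromatic_sum_complete_graph:
  assumes "finite V" and "odd p" and "card V \<le> p + 1"
    and "card (edges (complete_graph V)) = card V div 2 * p"
  shows "2 * edge_chromatic_sum (complete_graph V) = card V div 2 * p * (p + 1)"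
proof (rule antisym)
  obtain \<alpha> where "proper_edge_coloring (complete_graph V) \<alpha>" "\<And>e. \<alpha> e \<le> p"
    using exists_coloring_complete_graph[OF assms(1-3)] by blast
  then show "2 * edge_chromatic_sum (complete_graph V) \<le> card V div 2 * p * (p + 1)"
    using edge_chromatic_sum_le coloring_sum_le[OF assms(1)] by (meson le_trans mult_le_mono2)
next
  show "card V div 2 * p * (p + 1) \<le> 2 * edge_chromatic_sum (complete_graph V)"
    using edge_chromatic_sum_attained[OF finite_simple_graph_complete_graph[OF assms(1)]]
      coloring_sum_ge[OF assms(1) _ assms(4)] by metis
qed

theorem theorem6:
  fixes V :: "'a set" and n :: nat
  assumes "n \<ge> 1" and "finite V" and "card V = n"
  shows "real (edge_chromatic_sum (complete_graph V)) =
           (if odd n then real n * ((real n)\<^sup>2 - 1) / 4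
            else (real n - 1) * (real n)\<^sup>2 / 4)"
proof -
  have edges: "card (edges (complete_graph V)) = n * (n - 1) div 2"
    using n_subsets[OF assms(2), of 2] assms(3) by (simp add: complete_graph_def choose_two)
  show ?thesis
  proof (cases "odd n")
    case True
    then obtain k where k: "n = 2 * k + 1" by (rule oddE)
    \<comment> \<open>Take \<open>p = n\<close>; then \<open>n * (n - 1) div 2 = n div 2 * p\<close>
      as \<open>n - 1\<close> is even.\<close>
    have "2 * edge_chromatic_sum (complete_graph V) = n div 2 * n * (n + 1)"
      using edge_chromatic_sum_complete_graph[of V n] assms edges True k by simp
    then have "2 * real (edge_chromatic_sum (complete_graph V)) = real (n div 2 * n * (n + 1))"
      by (metis of_nat_mult of_nat_numeral)
    then show ?thesis using True k by (simp add: field_simps power2_eq_square)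
  next
    case False
    then obtain k where k: "n = 2 * k" by blast
    \<comment> \<open>Take \<open>p = n - 1\<close>, which is odd since \<open>n\<close> is even and
      positive.\<close>
    have "2 * edge_chromatic_sum (complete_graph V) = n div 2 * (n - 1) * (n - 1 + 1)"
      using edge_chromatic_sum_complete_graph[of V "n - 1"] assms edges False k by simp
    then have "2 * real (edge_chromatic_sum (complete_graph V)) =
        real (n div 2 * (n - 1) * (n - 1 + 1))"
      by (metis of_nat_mult of_nat_numeral)
    then show ?thesis using False k assms(1)
      by (simp add: field_simps power2_eq_square)
  qed
qed

end
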